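(* Consider Thiele's method (party version) for $N$ parties $1,\dots,N$, with some given numbers of votes $v_\sigma$, for $\sigma\subseteq\mathcal P=\{1,\dots,N\}$. Then, as $n\to\infty$, $\mathbf p_n\to\mathcal M$, in the sense that the (Euclidean) distance $d(\mathbf p_n,\mathcal M)\to0$. In particular, if $\mathcal M$ consists of a single point, i.e., $\mathcal M=\{\mathbf x_0\}$ for some $\mathbf x_0\in\mathfrak S$, then $\mathbf p_n\to\mathbf x_0$.
   Context: Thiele's method, party version: for each $\sigma\subseteq\mathcal P$, $v_\sigma\ge0$ is the (fixed) number of votes for the set $\sigma$ of parties. Seats are awarded one at a time. At each stage let $n_i$ be the number of seats so far awarded to party $i$ (initially $0$) and $n_\sigma:=\sum_{i\in\sigma}n_i$. The next seat goes to a party $i$ with the largest value of $W_i:=\sum_{\sigma\ni i}\frac{v_\sigma}{1+n_\sigma}$, ties being broken in an arbitrary way; each party may receive arbitrarily many seats. After $n\ge1$ seats have been distributed, $\mathbf p_n:=(n_1/n,\dots,n_N/n)$ is the vector of proportions of seats. Let $\mathfrak S:=\{(x_1,\dots,x_N):x_i\ge0,\ \sum_{i=1}^Nx_i=1\}$ and, for $x_1,\dots,x_N\ge0$, with $x_\sigma:=\sum_{i\in\sigma}x_i$ and the convention $0^0=1$, $$\Psi(x_1,\dots,x_N):=\prod_{\emptyset\ne\sigma\subseteq\mathcal P}x_\sigma^{v_\sigma}.$$ Let $M$ be the maximum of the continuous function $\Psi$ on the compact set $\mathfrak S$, and let $\mathcal M:=\{\mathbf x\in\mathfrak S:\Psi(\mathbf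 x)=M\}$. *)

theory Defs
  imports "HOL-Analysis.Analysis"
begin

text \<open>
  The parties are the elements of a finite type \<^typ>\<open>'n\<close>, so the number of parties is
  \<open>N = CARD('n)\<close>.  The votes are a function \<open>v :: 'n set \<Rightarrow> real\<close>.
\<close>

definition set_seats :: "('n::finite \<Rightarrow> nat) \<Rightarrow> 'n set \<Rightarrow> nat" where
  "set_seats s \<sigma> = (\<Sum>i\<in>\<sigma>. s i)"

definition thiele_weight :: "('n::finite set \<Rightarrow> real) \<Rightarrow> ('n \<Rightarrow> nat) \<Rightarrow> 'n \<Rightarrow> real" where
  "thiele_weight v s i = (\<Sum>\<sigma>\<in>{\<sigma>. i \<in> \<sigma>}. v \<sigma> / (1 + real (set_seats s \<sigma>)))"

text \<open>
  An outcome of the election is the sequence \<open>w\<close> of winners: \<open>w k\<close> is the party receiving the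
  seat awarded after \<open>k\<close> seats have already been distributed.
\<close>

definition seats :: "(nat \<Rightarrow> 'n::finite) \<Rightarrow> nat \<Rightarrow> 'n \<Rightarrow> nat" where
  "seats w n i = card {k. k < n \<and> w k = i}"

text \<open>
  A tie may be broken in any way, depending on the whole history; hence the method is a predicate
  on winner sequences rather than a function of the votes.
\<close>

definition thiele_election :: "('n::finite set \<Rightarrow> real) \<Rightarrow> (nat \<Rightarrow> 'n) \<Rightarrow> bool" where
  "thiele_election v w \<longleftrightarrow>
     (\<forall>k j. thiele_weight v (seats w k) j \<le> thiele_weight v (seats w k) (w k))"

text \<open>Only meaningful for \<open>n \<ge> 1\<close>.\<close>

definition proportions :: "(nat \<Rightarrow> 'n::finite) \<Rightarrow> nat \<Rightarrow> real ^ 'n" where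
  "proportions w n = (\<chi> i. real (seats w n i) / real n)"

definition prob_simplex :: "(real ^ 'n::finite) set" where
  "prob_simplex = {x. (\<forall>i. 0 \<le> x $ i) \<and> (\<Sum>i\<in>UNIV. x $ i) = 1}"

text \<open>The library has \<open>0 powr 0 = 0\<close>, whereas here the convention is \<open>0\<^sup>0 = 1\<close>.\<close>

definition rpow :: "real \<Rightarrow> real \<Rightarrow> real" where
  "rpow x a = (if a = 0 then 1 else x powr a)"

definition Psi :: "('n::finite set \<Rightarrow> real) \<Rightarrow> real ^ 'n \<Rightarrow> real" where
  "Psi v x = (\<Prod>\<sigma>\<in>{\<sigma>. \<sigma> \<noteq> {}}. rpow (\<Sum>i\<in>\<sigma>. x $ i) (v \<sigma>))"

text \<open>For \<open>v \<ge> 0\<close> the supremum is attained; see \<open>maximizers_nonempty\<close> below.\<close>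

definition Psi_max :: "('n::finite set \<Rightarrow> real) \<Rightarrow> real" where
  "Psi_max v = (SUP x\<in>prob_simplex. Psi v x)"

definition maximizers :: "('n::finite set \<Rightarrow> real) \<Rightarrow> (real ^ 'n) set" where
  "maximizers v = {x \<in> prob_simplex. Psi v x = Psi_max v}"

lemma compact_prob_simplex: "compact (prob_simplex :: (real ^ 'n::finite) set)"
proof -
  have "closed (prob_simplex :: (real ^ 'n) set)"
    unfolding prob_simplex_def
    by (intro closed_Collect_conj closed_Collect_all closed_Collect_le closed_Collect_eq
        continuous_intros)
  moreover have "bounded (prob_simplex :: (real ^ 'n) set)"
  proof (rule boundedI)
    fix x :: "real ^ 'n"
    assume x: "x \<in> prob_simplex"
    have "norm x \<le> (\<Sum>i\<in>UNIV. \<bar>x $ i\<bar>)"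
      by (rule norm_le_l1_cart)
    also have "\<dots> = 1"
      using x by (simp add: prob_simplex_def)
    finally show "norm x \<le> 1" .
  qed
  ultimately show ?thesis
    by (simp add: compact_eq_bounded_closed)
qed

lemma prob_simplex_nonempty: "(prob_simplex :: (real ^ 'n::finite) set) \<noteq> {}"
proof -
  have "(axis undefined 1 :: real ^ 'n) \<in> prob_simplex"
    by (simp add: prob_simplex_def axis_def)
  then show ?thesis
    by blast
qed

lemma continuous_on_Psi:
  assumes "\<And>\<sigma>. 0 \<le> v \<sigma>"
  shows "continuous_on prob_simplex (Psi v)"
  unfolding Psi_def
proof (rule continuous_on_prod)
  fix \<sigma>
  show "continuous_on prob_simplex (\<lambda>x. rpow (\<Sum>i\<in>\<sigma>. x $ i) (v \<sigma>))"
  proof (cases "v \<sigma> = 0")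
    case True
    then show ?thesis
      by (simp add: rpow_def)
  next
    case False
    then have "0 < v \<sigma>"
      using assms[of \<sigma>] by simp
    then have "continuous_on prob_simplex (\<lambda>x. (\<Sum>i\<in>\<sigma>. x $ i) powr v \<sigma>)"
      by (intro continuous_on_powr' continuous_intros)
        (auto simp: prob_simplex_def intro: sum_nonneg)
    then show ?thesis
      using False by (simp add: rpow_def)
  qed
qed

text \<open>
  In particular \<open>infdist\<close> to \<open>maximizers v\<close> is a genuine distance: the library sets \<open>infdist x {} = 0\<close>.
\<close>

lemma maximizers_nonempty:
  assumes "\<And>\<sigma>. 0 \<le> v \<sigma>"
  shows "maximizers v \<noteq> {}"
proof -
  obtain x where x: "x \<in> prob_simplex" "\<And>y. y \<in> prob_simplex \<Longrightarrow> Psi v y \<le> Psi v x"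
    using continuous_attains_sup[OF compact_prob_simplex prob_simplex_nonempty
        continuous_on_Psi[of v, OF assms]] by blast
  then have "Psi_max v = Psi v x"
    unfolding Psi_max_def by (intro cSup_eq_maximum) auto
  with x(1) show ?thesis
    by (auto simp: maximizers_def)
qed

end

theory Submission
  imports Defs
begin

text \<open>
  Thiele's method greedily increases \<open>\<Sum>\<^sub>\<sigma> v\<^sub>\<sigma> H(n\<^sub>\<sigma>)\<close>, where \<open>H\<close> denotes the harmonic numbers: awarding
  a seat to \<open>i\<close> increases this sum by exactly \<open>W\<^sub>i\<close>. The maximal \<open>W\<^sub>i\<close> is at least the average of the
  \<open>W\<^sub>i\<close> with weights given by a maximizer \<open>x\<close> of \<open>\<Psi>\<close>, and \<open>ln t \<le> t - 1\<close> bounds this average below in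
  terms of \<open>ln \<Psi>(x)\<close> and \<open>ln \<Psi>(p\<^sub>n)\<close>. As every \<open>n\<^sub>\<sigma>\<close> with \<open>v\<^sub>\<sigma> > 0\<close> tends to infinity,
  \<open>H(n\<^sub>\<sigma>) - ln n\<^sub>\<sigma>\<close> converges to Euler's constant, so that the deficit \<open>E\<^sub>n = ln \<Psi>(x) - ln \<Psi>(p\<^sub>n)\<close>
  satisfies, up to \<open>o(1)\<close> changes, \<open>n E\<^sub>n\<^sub>+\<^sub>1 \<le> (n - 1) E\<^sub>n + o(1)\<close> and hence tends to \<open>0\<close>.
  Compactness of the simplex then gives convergence of \<open>p\<^sub>n\<close> to the set of maximizers.
\<close>

section \<open>Two facts from analysis\<close>

text \<open>By compactness, \<open>f\<close> stays below some \<open>c < m\<close> on the points of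
  \<open>K\<close> at distance at least \<open>e\<close> from the argmax set, so \<open>X n\<close>
  eventually avoids them.\<close>

lemma infdist_argmax_tendsto_0:
  fixes f :: "'a::metric_space \<Rightarrow> real"
  assumes "compact K" and cont: "continuous_on K f"
    and ub: "\<And>x. x \<in> K \<Longrightarrow> f x \<le> m"
    and inK: "eventually (\<lambda>n. X n \<in> K) F"
    and lim: "\<And>c. c < m \<Longrightarrow> eventually (\<lambda>n. c < f (X n)) F"
  shows "((\<lambda>n. infdist (X n) {x \<in> K. f x = m}) \<longlongrightarrow> 0) F"
proof (rule tendstoI)
  fix e :: real
  assume "0 < e"
  let ?M = "{x \<in> K. f x = m}"
  define L where "L = K \<inter> {x. e \<le> infdist x ?M}"
  have "closed {x. e \<le> infdist x ?M}"
    by (intro closed_Collect_le continuous_intros)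
  then have "compact L"
    unfolding L_def using \<open>compact K\<close> by (rule compact_Int_closed[rotated])
  obtain c where c: "c < m" "\<And>x. x \<in> L \<Longrightarrow> f x \<le> c"
  proof (cases "L = {}")
    case True
    then show ?thesis
      using that[of "m - 1"] by auto
  next
    case False
    have "continuous_on L f"
      using cont by (rule continuous_on_subset) (auto simp: L_def)
    from continuous_attains_sup[OF \<open>compact L\<close> False this]
    obtain y where y: "y \<in> L" "\<forall>x\<in>L. f x \<le> f y"
      by blast
    have "f y \<noteq> m"
    proof
      assume "f y = m"
      then have "infdist y ?M = 0"
        using y(1) by (intro infdist_zero) (auto simp: L_def)
      then show False
        using y(1) \<open>0 < e\<close> by (simp add: L_def)
    qed
    then show ?thesis
      using that[of "f y"] y ub[of y] by (force simp: L_def)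
  qed
  from inK lim[OF c(1)] show "\<forall>\<^sub>F n in F. dist (infdist (X n) ?M) 0 < e"
  proof eventually_elim
    case (elim n)
    then have "X n \<notin> L"
      using c(2) by force
    then show ?case
      using elim by (auto simp: L_def infdist_nonneg)
  qed
qed

text \<open>Once \<open>d n < e / 2\<close>, the quantity \<open>(n - 1) * (E n - e / 2)\<close> no
  longer increases. Being bounded above, it lets \<open>E n\<close> exceed \<open>e / 2\<close> by
  at most O(1/n).\<close>

lemma eventually_less_of_averaging_recurrence:
  fixes E d :: "nat \<Rightarrow> real"
  assumes rec: "\<And>n. 1 \<le> n \<Longrightarrow> real n * E (Suc n) \<le> (real n - 1) * E n + d n"
    and d: "d \<longlonglongrightarrow> 0" and "0 < e"
  shows "eventually (\<lambda>n. E n < e) sequentially"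
proof -
  from order_tendstoD(2)[OF d, of "e / 2"] \<open>0 < e\<close>
  have "eventually (\<lambda>n. d n < e / 2) sequentially"
    by simp
  then obtain K0 where K0: "\<And>n. K0 \<le> n \<Longrightarrow> d n < e / 2"
    by (auto simp: eventually_sequentially)
  \<comment> \<open>At least 1, because \<open>rec\<close> starts there.\<close>
  define K where "K = max K0 1"
  define C where "C = (real K - 1) * (E K - e / 2)"
  have bound: "(real n - 1) * (E n - e / 2) \<le> C" if "K \<le> n" for n
    using that
  proof (induction n rule: dec_induct)
    case base
    then show ?case
      by (simp add: C_def)
  next
    case (step n)
    have "(real (Suc n) - 1) * (E (Suc n) - e / 2) = real n * E (Suc n) - real n * e / 2"
      by (simp add: algebra_simps)
    also have "\<dots> \<le> (real n - 1) * E n + d n - real n * e / 2"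
      using rec[of n] step by (simp add: K_def)
    also have "\<dots> \<le> (real n - 1) * (E n - e / 2)"
      using K0[of n] step by (simp add: K_def field_simps)
    finally show ?case
      using step by linarith
  qed
  have "eventually (\<lambda>n. 2 * C / e + 1 < real n) sequentially"
    using filterlim_real_sequentially by (simp add: filterlim_at_top_dense)
  then show ?thesis
    using eventually_ge_at_top[of "max K 2"]
  proof eventually_elim
    case (elim n)
    show ?case
    proof (rule ccontr)
      assume "\<not> E n < e"
      then have "(real n - 1) * (e / 2) \<le> (real n - 1) * (E n - e / 2)"
        using elim by (intro mult_left_mono) auto
      also have "\<dots> \<le> C"
        using bound[of n] elim by simp
      finally show False
        using elim \<open>0 < e\<close> by (simp add: field_simps)
    qed
  qed
qed

section \<open>Seat counts and proportions\<close>

lemma seats_Suc: "seats w (Suc n) i = seats w n i + of_bool (w n = i)"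
proof -
  have "{k. k < Suc n \<and> w k = i} = {k. k < n \<and> w k = i} \<union> (if w n = i then {n} else {})"
    by (auto simp: less_Suc_eq)
  then show ?thesis
    by (simp add: seats_def)
qed

lemma set_seats_Suc:
  "set_seats (seats w (Suc n)) \<sigma> = set_seats (seats w n) \<sigma> + of_bool (w n \<in> \<sigma>)"
  by (simp add: set_seats_def seats_Suc sum.distrib of_bool_def)

lemma set_seats_0 [simp]: "set_seats (seats w 0) \<sigma> = 0"
  by (simp add: set_seats_def seats_def)

lemma set_seats_UNIV: "set_seats (seats w n) UNIV = n"
  by (induction n) (simp_all add: set_seats_Suc)

lemma set_seats_mono: "m \<le> n \<Longrightarrow> set_seats (seats w m) \<sigma> \<le> set_seats (seats w n) \<sigma>"
  by (rule lift_Suc_mono_le[of "\<lambda>n. set_seats (seats w n) \<sigma>"]) (simp_all add: set_seats_Suc)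

lemma set_seats_le: "set_seats (seats w n) \<sigma> \<le> n"
  by (induction n) (auto simp: set_seats_Suc)

lemma sum_proportions: "(\<Sum>i\<in>\<sigma>. proportions w n $ i) = real (set_seats (seats w n) \<sigma>) / real n"
  by (simp add: proportions_def set_seats_def sum_divide_distrib)

lemma proportions_in_prob_simplex: "0 < n \<Longrightarrow> proportions w n \<in> prob_simplex"
  by (simp add: prob_simplex_def sum_proportions set_seats_UNIV) (simp add: proportions_def)

section \<open>Logarithmic form and positivity of the maximum of \<open>Psi\<close>\<close>

text \<open>
  Only these sets contribute; leaving out the other ones avoids the junk value \<open>ln 0 = 0\<close> in \<open>ln \<Psi>\<close>.
\<close>

definition support :: "('n::finite set \<Rightarrow> real) \<Rightarrow> 'n set set" where
  "support v = {\<sigma>. \<sigma> \<noteq> {} \<and> 0 < v \<sigma>}"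

lemma Psi_eq_prod_support:
  assumes "\<And>\<sigma>. 0 \<le> v \<sigma>"
  shows "Psi v x = (\<Prod>\<sigma>\<in>support v. (\<Sum>i\<in>\<sigma>. x $ i) powr v \<sigma>)"
proof -
  have "Psi v x = (\<Prod>\<sigma>\<in>support v. rpow (\<Sum>i\<in>\<sigma>. x $ i) (v \<sigma>))"
    unfolding Psi_def support_def using assms
    by (intro prod.mono_neutral_right) (auto simp: rpow_def order.order_iff_strict)
  also have "\<dots> = (\<Prod>\<sigma>\<in>support v. (\<Sum>i\<in>\<sigma>. x $ i) powr v \<sigma>)"
    by (intro prod.cong) (auto simp: rpow_def support_def)
  finally show ?thesis .
qed

text \<open>Positivity matters: with \<open>ln 0 = 0\<close>, a vanishing sum would contribute the
  factor 1 on the right but 0 on the left.\<close>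

lemma Psi_eq_exp:
  assumes "\<And>\<sigma>. 0 \<le> v \<sigma>" and "\<And>\<sigma>. \<sigma> \<in> support v \<Longrightarrow> 0 < (\<Sum>i\<in>\<sigma>. x $ i)"
  shows "Psi v x = exp (\<Sum>\<sigma>\<in>support v. v \<sigma> * ln (\<Sum>i\<in>\<sigma>. x $ i))"
  unfolding Psi_eq_prod_support[OF assms(1)] exp_sum[OF finite]
  using assms(2) by (intro prod.cong refl) (force simp: powr_def)

lemma Psi_le_Psi_max:
  fixes v :: "'n::finite set \<Rightarrow> real"
  assumes "\<And>\<sigma>. 0 \<le> v \<sigma>" and "x \<in> prob_simplex"
  shows "Psi v x \<le> Psi_max v"
  unfolding Psi_max_def
  using compact_continuous_image[OF continuous_on_Psi[of v, OF assms(1)] compact_prob_simplex]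
  by (intro cSUP_upper assms(2) bounded_imp_bdd_above compact_imp_bounded)

lemma Psi_max_pos:
  fixes v :: "'n::finite set \<Rightarrow> real"
  assumes "\<And>\<sigma>. 0 \<le> v \<sigma>"
  shows "0 < Psi_max v"
proof -
  \<comment> \<open>The barycentre of the simplex, where every nonempty set has a positive
    sum.\<close>
  define x :: "real ^ 'n" where "x = (\<chi> i. 1 / real CARD('n))"
  have "0 < (\<Sum>i\<in>\<sigma>. x $ i)" if "\<sigma> \<in> support v" for \<sigma>
    using that by (auto simp: x_def support_def card_gt_0_iff)
  then have "0 < Psi v x"
    using Psi_eq_exp[of v x] assms by simp
  also have "Psi v x \<le> Psi_max v"
    by (rule Psi_le_Psi_max[OF assms]) (simp add: x_def prob_simplex_def)
  finally show ?thesis .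
qed

text \<open>A vanishing factor would give \<open>Psi v x = 0\<close>, whereas the maximum is
  positive.\<close>

lemma sum_pos_of_maximizer:
  assumes "\<And>\<sigma>. 0 \<le> v \<sigma>" and "x \<in> maximizers v" and "\<sigma> \<in> support v"
  shows "0 < (\<Sum>i\<in>\<sigma>. x $ i)"
proof -
  have "Psi v x \<noteq> 0"
    using assms(2) Psi_max_pos[of v, OF assms(1)] by (simp add: maximizers_def)
  then have "(\<Sum>i\<in>\<sigma>. x $ i) \<noteq> 0"
    using assms(3) by (auto simp: Psi_eq_prod_support[OF assms(1)])
  moreover have "0 \<le> (\<Sum>i\<in>\<sigma>. x $ i)"
    using assms(2) by (intro sum_nonneg) (simp add: maximizers_def prob_simplex_def)
  ultimately show ?thesis
    by simp
qed

section \<open>Harmonic score and winning weights\<close>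

lemma thiele_weight_eq_sum_support:
  assumes "\<And>\<sigma>. 0 \<le> v \<sigma>"
  shows "thiele_weight v s i =
    (\<Sum>\<sigma>\<in>support v. of_bool (i \<in> \<sigma>) * (v \<sigma> / (1 + real (set_seats s \<sigma>))))"
proof -
  have "thiele_weight v s i =
      (\<Sum>\<sigma>\<in>UNIV. of_bool (i \<in> \<sigma>) * (v \<sigma> / (1 + real (set_seats s \<sigma>))))"
    unfolding thiele_weight_def by (rule sum.mono_neutral_cong_left) auto
  also have "\<dots> = (\<Sum>\<sigma>\<in>support v. of_bool (i \<in> \<sigma>) * (v \<sigma> / (1 + real (set_seats s \<sigma>))))"
    using assms by (intro sum.mono_neutral_right) (auto simp: support_def order.order_iff_strict)
  finally show ?thesis .
qed

definition harm_score :: "('n::finite set \<Rightarrow> real) \<Rightarrow> ('n \<Rightarrow> nat) \<Rightarrow> real" where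
  "harm_score v s = (\<Sum>\<sigma>\<in>support v. v \<sigma> * harm (set_seats s \<sigma>))"

lemma harm_score_Suc:
  assumes "\<And>\<sigma>. 0 \<le> v \<sigma>"
  shows "harm_score v (seats w (Suc n)) =
    harm_score v (seats w n) + thiele_weight v (seats w n) (w n)"
  unfolding harm_score_def thiele_weight_eq_sum_support[OF assms] sum.distrib[symmetric]
  by (intro sum.cong) (auto simp: set_seats_Suc harm_Suc distrib_left divide_inverse)

lemma harm_score_le:
  "harm_score v (seats w n) \<le> sum v (support v) * harm n"
  unfolding harm_score_def sum_distrib_right
  by (intro sum_mono mult_left_mono harm_mono set_seats_le) (auto simp: support_def)

text \<open>The winner's weight dominates every convex combination of the weights. Interchanging the
  two sums evaluates the combination with coefficients \<open>x\<close>.\<close>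

lemma average_le_winning_weight:
  assumes nonneg: "\<And>\<sigma>. 0 \<le> v \<sigma>" and "thiele_election v w" and x: "x \<in> prob_simplex"
  shows "(\<Sum>\<sigma>\<in>support v. v \<sigma> * (\<Sum>i\<in>\<sigma>. x $ i) / (1 + real (set_seats (seats w n) \<sigma>)))
    \<le> thiele_weight v (seats w n) (w n)"
proof -
  let ?c = "\<lambda>\<sigma>. v \<sigma> / (1 + real (set_seats (seats w n) \<sigma>))"
  have "(\<Sum>\<sigma>\<in>support v. v \<sigma> * (\<Sum>i\<in>\<sigma>. x $ i) / (1 + real (set_seats (seats w n) \<sigma>)))
      = (\<Sum>\<sigma>\<in>support v. \<Sum>i\<in>UNIV. x $ i * (of_bool (i \<in> \<sigma>) * ?c \<sigma>))"
  proof (intro sum.cong refl)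
    fix \<sigma>
    have "(\<Sum>i\<in>UNIV. x $ i * (of_bool (i \<in> \<sigma>) * ?c \<sigma>)) = (\<Sum>i\<in>\<sigma>. x $ i * ?c \<sigma>)"
      by (rule sum.mono_neutral_cong_right) auto
    also have "\<dots> = v \<sigma> * (\<Sum>i\<in>\<sigma>. x $ i) / (1 + real (set_seats (seats w n) \<sigma>))"
      by (simp add: sum_distrib_left mult.commute sum_divide_distrib)
    finally show "v \<sigma> * (\<Sum>i\<in>\<sigma>. x $ i) / (1 + real (set_seats (seats w n) \<sigma>)) =
        (\<Sum>i\<in>UNIV. x $ i * (of_bool (i \<in> \<sigma>) * ?c \<sigma>))"
      by simp
  qed
  also have "\<dots> = (\<Sum>i\<in>UNIV. x $ i * thiele_weight v (seats w n) i)"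
    by (subst sum.swap) (simp add: thiele_weight_eq_sum_support[OF nonneg] sum_distrib_left)
  also have "\<dots> \<le> (\<Sum>i\<in>UNIV. x $ i * thiele_weight v (seats w n) (w n))"
    using assms by (intro sum_mono mult_left_mono) (auto simp: thiele_election_def prob_simplex_def)
  also have "\<dots> = thiele_weight v (seats w n) (w n)"
    using x by (simp add: sum_distrib_right[symmetric] prob_simplex_def)
  finally show ?thesis .
qed

text \<open>Apply \<open>ln t \<le> t - 1\<close> to the ratio \<open>t\<close> of the sum of
  \<open>x\<close> over \<sigma> to \<open>(1 + n_\<sigma>) / n\<close>, for each \<sigma>.\<close>

lemma scaled_winning_weight_ge:
  assumes "\<And>\<sigma>. 0 \<le> v \<sigma>" and "thiele_election v w" and "x \<in> prob_simplex"
    and pos: "\<And>\<sigma>. \<sigma> \<in> support v \<Longrightarrow> 0 < (\<Sum>i\<in>\<sigma>. x $ i)" and n: "1 \<le> n"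
  shows "(\<Sum>\<sigma>\<in>support v. v \<sigma> * (1 + ln (\<Sum>i\<in>\<sigma>. x $ i)
      - ln ((1 + real (set_seats (seats w n) \<sigma>)) / real n)))
    \<le> real n * thiele_weight v (seats w n) (w n)"
proof -
  have "(\<Sum>\<sigma>\<in>support v. v \<sigma> * (1 + ln (\<Sum>i\<in>\<sigma>. x $ i)
      - ln ((1 + real (set_seats (seats w n) \<sigma>)) / real n)))
    \<le> (\<Sum>\<sigma>\<in>support v. v \<sigma> * (real n * (\<Sum>i\<in>\<sigma>. x $ i) / (1 + real (set_seats (seats w n) \<sigma>))))"
  proof (intro sum_mono mult_left_mono)
    fix \<sigma>
    assume \<sigma>: "\<sigma> \<in> support v"
    let ?y = "(1 + real (set_seats (seats w n) \<sigma>)) / real n"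
    have y: "0 < ?y"
      using n by (intro divide_pos_pos) auto
    have "ln ((\<Sum>i\<in>\<sigma>. x $ i) / ?y) \<le> (\<Sum>i\<in>\<sigma>. x $ i) / ?y - 1"
      by (intro ln_le_minus_one divide_pos_pos pos \<sigma> y)
    then show "1 + ln (\<Sum>i\<in>\<sigma>. x $ i) - ln ?y
        \<le> real n * (\<Sum>i\<in>\<sigma>. x $ i) / (1 + real (set_seats (seats w n) \<sigma>))"
      using ln_divide_pos[OF pos[OF \<sigma>] y] by (simp add: mult.commute)
  qed (simp add: assms(1))
  also have "\<dots> = real n *
      (\<Sum>\<sigma>\<in>support v. v \<sigma> * (\<Sum>i\<in>\<sigma>. x $ i) / (1 + real (set_seats (seats w n) \<sigma>)))"
    by (simp add: sum_distrib_left mult_ac)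
  also have "\<dots> \<le> real n * thiele_weight v (seats w n) (w n)"
    by (intro mult_left_mono average_le_winning_weight assms) auto
  finally show ?thesis .
qed

section \<open>Divergence of the seat counts\<close>

lemma harm_over_n_tendsto_0: "(\<lambda>n. harm n / real n) \<longlonglongrightarrow> 0"
proof -
  have "(\<lambda>n. (harm n - ln (real n)) * inverse (real n) + ln (real n) / real n)
      \<longlonglongrightarrow> euler_mascheroni * 0 + 0"
    by (intro tendsto_intros euler_mascheroni_LIMSEQ lim_inverse_n lim_ln_over_n)
  moreover have "(harm n - ln (real n)) * inverse (real n) + ln (real n) / real n = harm n / real n"
    for n
    by (simp add: divide_inverse left_diff_distrib)
  ultimately show ?thesis
    by simp
qed

text \<open>
  Otherwise \<open>W\<^sub>i\<close> would stay bounded below for any \<open>i \<in> \<sigma>\<close>, and the harmonic score would grow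
  linearly rather than logarithmically.
\<close>

lemma set_seats_at_top:
  assumes nonneg: "\<And>\<sigma>. 0 \<le> v \<sigma>" and el: "thiele_election v w" and \<sigma>: "\<sigma> \<in> support v"
  shows "filterlim (\<lambda>n. set_seats (seats w n) \<sigma>) at_top sequentially"
proof (rule ccontr)
  assume "\<not> ?thesis"
  then obtain K where K: "\<not> eventually (\<lambda>n. K \<le> set_seats (seats w n) \<sigma>) sequentially"
    by (auto simp: filterlim_at_top)
  \<comment> \<open>Seat counts are monotone, so one that reached \<open>K\<close> would stay at or
    above \<open>K\<close>.\<close>
  have bdd: "set_seats (seats w n) \<sigma> \<le> K" for n
    using K set_seats_mono[of n _ w \<sigma>] unfolding eventually_sequentially
    by (meson le_trans nle_le)
  define c where "c = v \<sigma> / (1 + real K)"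
  have "0 < c"
    using \<sigma> by (simp add: c_def support_def)
  obtain i where i: "i \<in> \<sigma>"
    using \<sigma> by (auto simp: support_def)
  have step: "c \<le> thiele_weight v (seats w n) (w n)" for n
  proof -
    have "c \<le> v \<sigma> / (1 + real (set_seats (seats w n) \<sigma>))"
      unfolding c_def using bdd[of n] nonneg by (intro divide_left_mono) auto
    also have "\<dots> \<le> thiele_weight v (seats w n) i"
      unfolding thiele_weight_def using i nonneg
      by (intro member_le_sum[where f = "\<lambda>\<sigma>. v \<sigma> / (1 + real (set_seats (seats w n) \<sigma>))"]) auto
    also have "\<dots> \<le> thiele_weight v (seats w n) (w n)"
      using el by (simp add: thiele_election_def)
    finally show ?thesis .
  qed
  have lin: "c * real n \<le> harm_score v (seats w n)" for n
  proof (induction n)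
    case 0
    then show ?case
      by (simp add: harm_score_def harm_def)
  next
    case (Suc n)
    then show ?case
      using step[of n] harm_score_Suc[of v w n, OF nonneg] by (simp add: algebra_simps)
  qed
  have "(\<lambda>n. sum v (support v) * (harm n / real n)) \<longlonglongrightarrow> sum v (support v) * 0"
    by (intro tendsto_intros harm_over_n_tendsto_0)
  then have "eventually (\<lambda>n. sum v (support v) * (harm n / real n) < c) sequentially"
    using \<open>0 < c\<close> by (intro order_tendstoD(2)) auto
  then have "eventually (\<lambda>n. sum v (support v) * (harm n / real n) < c \<and> 1 \<le> n) sequentially"
    using eventually_ge_at_top by (rule eventually_conj)
  then obtain n where n: "sum v (support v) * (harm n / real n) < c" "1 \<le> n"
    using eventually_happens'[OF sequentially_bot] by blast
  from n have "sum v (support v) * harm n < c * real n"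
    by (simp add: field_simps)
  with lin[of n] harm_score_le[of v w n] show False
    by linarith
qed

section \<open>Convergence of \<open>Psi\<close> along the proportions\<close>

lemma harm_minus_ln_Suc_tendsto:
  "(\<lambda>n. harm n - ln (1 + real n)) \<longlonglongrightarrow> (euler_mascheroni :: real)"
proof -
  have "(\<lambda>n. harm (Suc n) - ln (real (Suc n)) - inverse (real (Suc n)))
      \<longlonglongrightarrow> (euler_mascheroni :: real) - 0"
    by (intro tendsto_diff LIMSEQ_Suc[OF euler_mascheroni_LIMSEQ] LIMSEQ_inverse_real_of_nat)
  then show ?thesis
    by (simp add: harm_Suc)
qed

lemma ln_Suc_minus_ln_tendsto_0: "(\<lambda>n. ln (1 + real n) - ln (real n)) \<longlonglongrightarrow> 0"
  using tendsto_diff[OF euler_mascheroni_LIMSEQ harm_minus_ln_Suc_tendsto] by simp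

text \<open>\<open>P\<close> and, once all counts are positive, \<open>Q n\<close> are the
  logarithms of \<open>Psi\<close> at a maximizer and at the proportions. The recurrence is run on
  \<open>P - B n\<close>, since the increments of \<open>B\<close> are explicit; \<open>G n\<close>,
  from the bound on the winning weight, differs from both \<open>B n\<close> and \<open>Q n\<close>
  by o(1).\<close>

lemma eventually_less_Psi_proportions:
  assumes nonneg: "\<And>\<sigma>. 0 \<le> v \<sigma>" and el: "thiele_election v w" and c: "c < Psi_max v"
  shows "eventually (\<lambda>n. c < Psi v (proportions w n)) sequentially"
proof -
  let ?S = "support v"
  define V where "V = sum v ?S"
  define N where "N n \<sigma> = set_seats (seats w n) \<sigma>" for n \<sigma>
  obtain x where x: "x \<in> maximizers v"
    using maximizers_nonempty[of v, OF nonneg] by blast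
  then have simplex: "x \<in> prob_simplex" and max: "Psi v x = Psi_max v"
    by (auto simp: maximizers_def)
  note pos = sum_pos_of_maximizer[OF nonneg x]
  define P where "P = (\<Sum>\<sigma>\<in>?S. v \<sigma> * ln (\<Sum>i\<in>\<sigma>. x $ i))"
  define Q where "Q n = (\<Sum>\<sigma>\<in>?S. v \<sigma> * ln (real (N n \<sigma>) / real n))" for n
  define G where "G n = (\<Sum>\<sigma>\<in>?S. v \<sigma> * ln ((1 + real (N n \<sigma>)) / real n))" for n
  define B where "B n = harm_score v (seats w n) - V * harm n" for n
  have N_top: "filterlim (\<lambda>n. N n \<sigma>) at_top sequentially" if "\<sigma> \<in> ?S" for \<sigma>
    unfolding N_def by (rule set_seats_at_top[OF nonneg el that])
  have N_pos: "eventually (\<lambda>n. \<forall>\<sigma>\<in>?S. 0 < N n \<sigma>) sequentially"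
  proof (rule eventually_ball_finite[OF finite], rule ballI)
    fix \<sigma>
    assume "\<sigma> \<in> ?S"
    from N_top[OF this] have "eventually (\<lambda>n. 1 \<le> N n \<sigma>) sequentially"
      unfolding filterlim_at_top by blast
    then show "eventually (\<lambda>n. 0 < N n \<sigma>) sequentially"
      by eventually_elim simp
  qed
  have GB: "(\<lambda>n. G n - B n) \<longlonglongrightarrow> 0"
  proof -
    \<comment> \<open>The terms \<open>V * ln n\<close> cancel in \<open>G n - B n\<close>, and so
      do the Euler constants in the limit, as \<open>V\<close> is the sum of the
      \<open>v \<sigma>\<close>.\<close>
    have "(\<lambda>n. V * (harm n - ln (real n)) - (\<Sum>\<sigma>\<in>?S. v \<sigma> * (harm (N n \<sigma>) - ln (1 + real (N n \<sigma>)))))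
        \<longlonglongrightarrow> V * euler_mascheroni - (\<Sum>\<sigma>\<in>?S. v \<sigma> * euler_mascheroni)"
      by (intro tendsto_intros euler_mascheroni_LIMSEQ
          filterlim_compose[OF harm_minus_ln_Suc_tendsto] N_top)
    moreover have "eventually (\<lambda>n. V * (harm n - ln (real n))
        - (\<Sum>\<sigma>\<in>?S. v \<sigma> * (harm (N n \<sigma>) - ln (1 + real (N n \<sigma>)))) = G n - B n) sequentially"
      using eventually_gt_at_top[of 0]
    proof eventually_elim
      case (elim n)
      have "ln ((1 + real (N n \<sigma>)) / real n) = ln (1 + real (N n \<sigma>)) - ln (real n)" for \<sigma>
        using elim by (intro ln_divide_pos) auto
      then show ?case
        by (simp add: G_def B_def V_def harm_score_def N_def right_diff_distrib sum_subtractf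
            sum_distrib_right)
    qed
    ultimately show ?thesis
      by (auto simp: V_def sum_distrib_right dest: Lim_transform_eventually)
  qed
  have GQ: "(\<lambda>n. G n - Q n) \<longlonglongrightarrow> 0"
  proof -
    have "(\<lambda>n. (\<Sum>\<sigma>\<in>?S. v \<sigma> * (ln (1 + real (N n \<sigma>)) - ln (real (N n \<sigma>)))))
        \<longlonglongrightarrow> (\<Sum>\<sigma>\<in>?S. v \<sigma> * 0)"
      by (intro tendsto_intros filterlim_compose[OF ln_Suc_minus_ln_tendsto_0] N_top)
    moreover have "eventually (\<lambda>n. (\<Sum>\<sigma>\<in>?S. v \<sigma> * (ln (1 + real (N n \<sigma>)) - ln (real (N n \<sigma>))))
        = G n - Q n) sequentially"
      using N_pos eventually_gt_at_top[of 0]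
    proof eventually_elim
      case (elim n)
      have "ln ((1 + real (N n \<sigma>)) / real n) = ln (1 + real (N n \<sigma>)) - ln (real n)"
        "ln (real (N n \<sigma>) / real n) = ln (real (N n \<sigma>)) - ln (real n)" if "\<sigma> \<in> ?S" for \<sigma>
        using elim that by (auto intro!: ln_divide_pos)
      then show ?case
        by (simp add: G_def Q_def right_diff_distrib sum_subtractf)
    qed
    ultimately show ?thesis
      by (auto dest: Lim_transform_eventually)
  qed
  \<comment> \<open>Since \<open>V * n / (n + 1) \<le> V\<close>, the \<open>V\<close> in the weight
    bound absorbs the loss from \<open>V * harm n\<close>, leaving
    \<open>n * (B (Suc n) - B n) \<ge> P - G n\<close>.\<close>
  have rec: "real n * (P - B (Suc n)) \<le> (real n - 1) * (P - B n) + (G n - B n)" if "1 \<le> n" for n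
  proof -
    have "V + P - G n \<le> real n * thiele_weight v (seats w n) (w n)"
      using scaled_winning_weight_ge[OF nonneg el simplex pos that]
      by (simp add: V_def P_def G_def N_def algebra_simps sum.distrib sum_subtractf)
    moreover have "B (Suc n) - B n = thiele_weight v (seats w n) (w n) - V / real (Suc n)"
      by (simp add: B_def harm_score_Suc[OF nonneg] harm_Suc algebra_simps divide_inverse)
    then have "real n * (B (Suc n) - B n)
        = real n * thiele_weight v (seats w n) (w n) - V * (real n / real (Suc n))"
      by (simp add: right_diff_distrib)
    moreover have "V * (real n / real (Suc n)) \<le> V * 1"
      by (intro mult_left_mono) (auto simp: V_def support_def intro!: sum_nonneg)
    ultimately show ?thesis
      by (simp add: algebra_simps)
  qed
  \<comment> \<open>Raises \<open>c\<close> to a positive level still below the maximum, so that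
    \<open>ln c'\<close> can be used.\<close>
  define c' where "c' = max c (Psi_max v / 2)"
  have c': "0 < c'" "c \<le> c'" "c' < Psi_max v"
    using c Psi_max_pos[of v, OF nonneg] by (auto simp: c'_def)
  have expP: "exp P = Psi_max v"
    unfolding P_def max[symmetric] by (rule Psi_eq_exp[OF nonneg pos, symmetric])
  define e where "e = P - ln c'"
  have "0 < e"
    using c' expP by (metis e_def diff_gt_0_iff_gt exp_ln exp_less_cancel_iff)
  have "eventually (\<lambda>n. P - B n < e / 2) sequentially"
    using \<open>0 < e\<close> by (intro eventually_less_of_averaging_recurrence[OF rec GB]) auto
  \<comment> \<open>This difference is \<open>B n - Q n\<close>; the other half of \<open>e\<close>
    pays for replacing \<open>B n\<close> by \<open>Q n\<close>.\<close>
  moreover have "(\<lambda>n. (G n - Q n) - (G n - B n)) \<longlonglongrightarrow> 0 - 0"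
    by (intro tendsto_diff GB GQ)
  then have "eventually (\<lambda>n. (G n - Q n) - (G n - B n) < e / 2) sequentially"
    using \<open>0 < e\<close> by (intro order_tendstoD(2)) auto
  ultimately show ?thesis
    using N_pos eventually_gt_at_top[of 0]
  proof eventually_elim
    case (elim n)
    have "Psi v (proportions w n) = exp (Q n)"
      using elim Psi_eq_exp[of v "proportions w n", OF nonneg]
      by (simp add: sum_proportions Q_def N_def)
    moreover have "ln c' < Q n"
      using elim(1,2) by (simp add: e_def field_simps)
    then have "c' < exp (Q n)"
      using c'(1) by (metis exp_less_mono exp_ln)
    ultimately show ?case
      using c'(2) by simp
  qed
qed

theorem theorem12p5:
  fixes v :: "'n::finite set \<Rightarrow> real"
    and w :: "nat \<Rightarrow> 'n"
  assumes votes_nonneg: "\<And>\<sigma>. 0 \<le> v \<sigma>"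
    and election: "thiele_election v w"
  shows "((\<lambda>n. infdist (proportions w n) (maximizers v)) \<longlonglongrightarrow> 0) \<and>
         (\<forall>x\<^sub>0. maximizers v = {x\<^sub>0} \<longrightarrow> (proportions w \<longlonglongrightarrow> x\<^sub>0))"
proof -
  have *: "(\<lambda>n. infdist (proportions w n) (maximizers v)) \<longlonglongrightarrow> 0"
    unfolding maximizers_def
  proof (rule infdist_argmax_tendsto_0[OF compact_prob_simplex])
    show "continuous_on prob_simplex (Psi v)"
      by (rule continuous_on_Psi[OF votes_nonneg])
    show "Psi v x \<le> Psi_max v" if "x \<in> prob_simplex" for x
      using votes_nonneg that by (rule Psi_le_Psi_max)
    show "eventually (\<lambda>n. proportions w n \<in> prob_simplex) sequentially"
      using eventually_gt_at_top[of 0] by eventually_elim (rule proportions_in_prob_simplex)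
    show "eventually (\<lambda>n. c < Psi v (proportions w n)) sequentially" if "c < Psi_max v" for c
      using votes_nonneg election that by (rule eventually_less_Psi_proportions)
  qed
  \<comment> \<open>\<open>infdist\<close> to a singleton is \<open>dist\<close>.\<close>
  moreover have "proportions w \<longlonglongrightarrow> x\<^sub>0" if "maximizers v = {x\<^sub>0}" for x\<^sub>0
    using * unfolding that tendsto_dist_iff[of "proportions w"] by simp
  ultimately show ?thesis
    by blast
qed

end
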